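(* Fix $n\ge3$, and let $\omega:VL_n\longrightarrow\mathrm{GL}_n(\mathbb{C})$ be a non-trivial complex homogeneous $2$-local representation of the virtual triplet group $VL_n$. Then $\omega$ is equivalent to one of the following two representations, given on the generators for $1\le i\le n-1$. (1) $\omega_1:VL_n\to\mathrm{GL}_n(\mathbb{C})$ with \[ \omega_1(\ell_i)=\begin{pmatrix} I_{i-1}&0&0\\ 0&\begin{pmatrix}0&b\\ \frac1b&0\end{pmatrix}&0\\ 0&0&I_{n-i-1}\end{pmatrix},\qquad \omega_1(\rho_i)=\begin{pmatrix} I_{i-1}&0&0\\ 0&\begin{pmatrix}0&x\\ \frac1x&0\end{pmatrix}&0\\ 0&0&I_{n-i-1}\end{pmatrix}, \] where $b,x\in\mathbb{C}^*$. (2) $\omega_2:VL_n\to\mathrm{GL}_n(\mathbb{C})$ with \[ \omega_2(\ell_i)=I_n,\qquad \omega_2(\rho_i)=\begin{pmatrix} I_{i-1}&0&0\\ 0&\begin{pmatrix}0&x\\ \frac1x&0\end{pmatrix}&0\\ 0&0&I_{n-i-1}\end{pmatrix}, \] where $x\in\mathbb{C}^*$. Moreover, among these two representations of $VL_n$, only $\omega_1$ defines a representation of the welded triplet group $WL_n$.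
   Context: The virtual triplet group $VL_n$ is generated by $\ell_1,\ldots,\ell_{n-1},\rho_1,\ldots,\rho_{n-1}$ subject to: $\ell_i^2=1$ and $\rho_i^2=1$ ($1\le i\le n-1$); $\ell_i\ell_{i+1}\ell_i=\ell_{i+1}\ell_i\ell_{i+1}$ and $\rho_i\rho_{i+1}\rho_i=\rho_{i+1}\rho_i\rho_{i+1}$ ($1\le i\le n-2$); $\rho_i\rho_j=\rho_j\rho_i$ and $\ell_i\rho_j=\rho_j\ell_i$ ($|i-j|\ge2$); $\rho_i\rho_{i+1}\ell_i=\ell_{i+1}\rho_i\rho_{i+1}$ ($1\le i\le n-2$). (No commutation relations among the $\ell_i$ are imposed.) The welded triplet group $WL_n$ is the quotient of $VL_n$ by the additional relations $\rho_i\ell_{i+1}\ell_i=\ell_{i+1}\ell_i\rho_{i+1}$ ($1\le i\le n-2$). A representation of $VL_n$ defines a representation of $WL_n$ if it factors through this quotient. A representation $\omega:VL_n\to\mathrm{GL}_n(\mathbb{C})$ is homogeneous $2$-local if there are matrices $M,N\in\mathrm{GL}_2(\mathbb{C})$ such that for every $1\le i\le n-1$, $\omega(\ell_i)$ is block diagonal with blocks $I_{i-1},M,I_{n-i-1}$ and $\omega(\rho_i)$ is block diagonal with blocks $I_{i-1},N,I_{n-i-1}$, where $I_r$ is the $r\times r$ identity matrix. It is non-trivial if $M$ and $N$ are not both the identity $I_2$. Two representations into $\mathrm{GL}_n(\mathbb{C})$ are equivalent if they are conjugate by an element of $\mathrm{GL}_n(\mathbb{C})$. *)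

theory Defs
  imports Jordan_Normal_Form.Matrix "HOL-Algebra.Coset"
begin

text \<open>A letter \<open>(s, True)\<close> stands for the generator \<open>s\<close> and \<open>(s, False)\<close> for its formal
  inverse. A pair \<open>(u, v)\<close> in \<open>R\<close> is the relation \<open>u = v\<close>; pairs that are not words over \<open>S\<close>
  are ignored.\<close>

type_synonym 's word = "('s \<times> bool) list"

definition words :: "'s set \<Rightarrow> 's word set" where
  "words S = lists (S \<times> UNIV)"

inductive_set pres_cong :: "'s set \<Rightarrow> ('s word \<times> 's word) set \<Rightarrow> ('s word \<times> 's word) set"
  for S R where
  refl: "w \<in> words S \<Longrightarrow> (w, w) \<in> pres_cong S R"
| sym: "(u, v) \<in> pres_cong S R \<Longrightarrow> (v, u) \<in> pres_cong S R"
| trans: "(u, v) \<in> pres_cong S R \<Longrightarrow> (v, w) \<in> pres_cong S R \<Longrightarrow> (u, w) \<in> pres_cong S R"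
| append: "(u, u') \<in> pres_cong S R \<Longrightarrow> (v, v') \<in> pres_cong S R \<Longrightarrow> (u @ v, u' @ v') \<in> pres_cong S R"
| cancel: "s \<in> S \<Longrightarrow> ([(s, e), (s, \<not> e)], []) \<in> pres_cong S R"
| rel: "(u, v) \<in> R \<Longrightarrow> u \<in> words S \<Longrightarrow> v \<in> words S \<Longrightarrow> (u, v) \<in> pres_cong S R"

definition presented_group :: "'s set \<Rightarrow> ('s word \<times> 's word) set \<Rightarrow> 's word set monoid" where
  "presented_group S R =
    \<lparr>carrier = words S // pres_cong S R,
     mult = (\<lambda>A B. \<Union>u\<in>A. \<Union>v\<in>B. pres_cong S R `` {u @ v}),
     one = pres_cong S R `` {[]}\<rparr>"

lemma pres_cong_words: "(u, v) \<in> pres_cong S R \<Longrightarrow> u \<in> words S \<and> v \<in> words S"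
  by (induction rule: pres_cong.induct) (auto simp: words_def)

lemma equiv_pres_cong: "equiv (words S) (pres_cong S R)"
  by (rule equivI)
    (auto simp: refl_on_def sym_on_def trans_on_def dest: pres_cong_words
      intro: pres_cong.refl pres_cong.sym pres_cong.trans)

lemma presented_group_mult:
  assumes "u \<in> words S" "v \<in> words S"
  shows "(pres_cong S R `` {u}) \<otimes>\<^bsub>presented_group S R\<^esub> (pres_cong S R `` {v})
    = pres_cong S R `` {u @ v}"
proof -
  have "congruent2 (pres_cong S R) (pres_cong S R) (\<lambda>u v. pres_cong S R `` {u @ v})"
    unfolding congruent2_def
    by (auto intro!: equiv_class_eq[OF equiv_pres_cong] pres_cong.append)
  from UN_equiv_class2[OF equiv_pres_cong equiv_pres_cong this assms]
  show ?thesis by (simp add: presented_group_def)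
qed

lemma pres_cong_inverse:
  "w \<in> words S \<Longrightarrow> (map (\<lambda>(s, e). (s, \<not> e)) (rev w) @ w, []) \<in> pres_cong S R"
proof (induction w)
  case Nil
  then show ?case by (auto intro: pres_cong.refl)
next
  case (Cons a w)
  obtain s e where a: "a = (s, e)" by force
  have s: "s \<in> S" and w: "w \<in> words S" using Cons.prems by (auto simp: a words_def)
  let ?i = "map (\<lambda>(s, e). (s, \<not> e)) (rev w)"
  have i: "?i \<in> words S" using w by (auto simp: words_def)
  have "([(s, \<not> e), (s, e)], []) \<in> pres_cong S R" using pres_cong.cancel[OF s, of "\<not> e"] by simp
  from pres_cong.append[OF pres_cong.refl[OF i] pres_cong.append[OF this pres_cong.refl[OF w]]]
  have "(?i @ [(s, \<not> e), (s, e)] @ w, ?i @ w) \<in> pres_cong S R" by simp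
  with Cons.IH[OF w] show ?case by (auto simp: a intro: pres_cong.trans)
qed

lemma group_presented_group: "group (presented_group S R)"
proof (rule groupI)
  let ?G = "presented_group S R" and ?c = "\<lambda>w. pres_cong S R `` {w}"
  have app: "u @ v \<in> words S" if "u \<in> words S" "v \<in> words S" for u v
    using that by (auto simp: words_def)
  have nil: "[] \<in> words S" by (simp add: words_def)
  have car: "carrier ?G = words S // pres_cong S R" and one: "\<one>\<^bsub>?G\<^esub> = ?c []"
    by (simp_all add: presented_group_def)
  note m = presented_group_mult
  show "x \<otimes>\<^bsub>?G\<^esub> y \<in> carrier ?G" if "x \<in> carrier ?G" "y \<in> carrier ?G" for x y
    using that unfolding car by (auto elim!: quotientE simp: m app intro!: quotientI)
  show "\<one>\<^bsub>?G\<^esub> \<in> carrier ?G"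
    unfolding car one by (rule quotientI[OF nil])
  show "x \<otimes>\<^bsub>?G\<^esub> y \<otimes>\<^bsub>?G\<^esub> z = x \<otimes>\<^bsub>?G\<^esub> (y \<otimes>\<^bsub>?G\<^esub> z)"
    if "x \<in> carrier ?G" "y \<in> carrier ?G" "z \<in> carrier ?G" for x y z
    using that unfolding car by (auto elim!: quotientE simp: m app)
  show "\<one>\<^bsub>?G\<^esub> \<otimes>\<^bsub>?G\<^esub> x = x" if "x \<in> carrier ?G" for x
    using that unfolding car one by (auto elim!: quotientE simp: m nil)
  show "\<exists>y\<in>carrier ?G. y \<otimes>\<^bsub>?G\<^esub> x = \<one>\<^bsub>?G\<^esub>" if x: "x \<in> carrier ?G" for x
  proof -
    obtain w where w: "w \<in> words S" "x = ?c w" using x unfolding car by (elim quotientE)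
    let ?i = "map (\<lambda>(s, e). (s, \<not> e)) (rev w)"
    have i: "?i \<in> words S" using w by (auto simp: words_def)
    have "?c ?i \<otimes>\<^bsub>?G\<^esub> x = ?c []"
      using equiv_class_eq[OF equiv_pres_cong pres_cong_inverse[OF w(1)]]
      by (simp only: w m i)
    moreover have "?c ?i \<in> carrier ?G" unfolding car by (rule quotientI[OF i])
    ultimately show ?thesis unfolding one by blast
  qed
qed

datatype vl_gen = Ell nat | Rho nat

abbreviation l_word :: "nat \<Rightarrow> vl_gen word" where "l_word i \<equiv> [(Ell i, True)]"
abbreviation r_word :: "nat \<Rightarrow> vl_gen word" where "r_word i \<equiv> [(Rho i, True)]"

definition VL_gens :: "nat \<Rightarrow> vl_gen set" where
  "VL_gens n = Ell ` {1..<n} \<union> Rho ` {1..<n}"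

definition VL_rels :: "nat \<Rightarrow> (vl_gen word \<times> vl_gen word) set" where
  "VL_rels n =
     {(l_word i @ l_word i, []) | i. 1 \<le> i \<and> i < n}
   \<union> {(r_word i @ r_word i, []) | i. 1 \<le> i \<and> i < n}
   \<union> {(l_word i @ l_word (i+1) @ l_word i, l_word (i+1) @ l_word i @ l_word (i+1)) | i.
        1 \<le> i \<and> i + 1 < n}
   \<union> {(r_word i @ r_word (i+1) @ r_word i, r_word (i+1) @ r_word i @ r_word (i+1)) | i.
        1 \<le> i \<and> i + 1 < n}
   \<union> {(r_word i @ r_word j, r_word j @ r_word i) | i j.
        1 \<le> i \<and> i < n \<and> 1 \<le> j \<and> j < n \<and> \<bar>int i - int j\<bar> \<ge> 2}
   \<union> {(l_word i @ r_word j, r_word j @ l_word i) | i j.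
        1 \<le> i \<and> i < n \<and> 1 \<le> j \<and> j < n \<and> \<bar>int i - int j\<bar> \<ge> 2}
   \<union> {(r_word i @ r_word (i+1) @ l_word i, l_word (i+1) @ r_word i @ r_word (i+1)) | i.
        1 \<le> i \<and> i + 1 < n}"

definition VL :: "nat \<Rightarrow> vl_gen word set monoid" where
  "VL n = presented_group (VL_gens n) (VL_rels n)"

definition ell :: "nat \<Rightarrow> nat \<Rightarrow> vl_gen word set" where
  "ell n i = pres_cong (VL_gens n) (VL_rels n) `` {l_word i}"

definition rho :: "nat \<Rightarrow> nat \<Rightarrow> vl_gen word set" where
  "rho n i = pres_cong (VL_gens n) (VL_rels n) `` {r_word i}"

definition normal_closure :: "('a, 'b) monoid_scheme \<Rightarrow> 'a set \<Rightarrow> 'a set" where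
  "normal_closure G A = \<Inter>{H. H \<lhd> G \<and> A \<subseteq> H}"

text \<open>The relation \<open>u = v\<close> is imposed on \<open>VL n\<close> by killing \<open>u v\<^sup>-\<^sup>1\<close>.\<close>

definition welded_relators :: "nat \<Rightarrow> vl_gen word set set" where
  "welded_relators n =
    {(rho n i \<otimes>\<^bsub>VL n\<^esub> ell n (i+1) \<otimes>\<^bsub>VL n\<^esub> ell n i)
       \<otimes>\<^bsub>VL n\<^esub> inv\<^bsub>VL n\<^esub> (ell n (i+1) \<otimes>\<^bsub>VL n\<^esub> ell n i \<otimes>\<^bsub>VL n\<^esub> rho n (i+1)) | i.
     1 \<le> i \<and> i + 1 < n}"

definition welded_kernel :: "nat \<Rightarrow> vl_gen word set set" where
  "welded_kernel n = normal_closure (VL n) (welded_relators n)"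

definition WL :: "nat \<Rightarrow> vl_gen word set set monoid" where
  "WL n = VL n Mod welded_kernel n"

definition GL :: "nat \<Rightarrow> complex mat monoid" where
  "GL n = units_of (ring_mat TYPE(complex) n ())"

definition local_block :: "nat \<Rightarrow> nat \<Rightarrow> complex mat \<Rightarrow> complex mat" where
  "local_block n i M = diag_block_mat [1\<^sub>m (i - 1), M, 1\<^sub>m (n - i - 1)]"

definition homogeneous_2_local ::
  "nat \<Rightarrow> complex mat \<Rightarrow> complex mat \<Rightarrow> (vl_gen word set \<Rightarrow> complex mat) \<Rightarrow> bool" where
  "homogeneous_2_local n M N \<omega> \<longleftrightarrow>
     M \<in> carrier (GL 2) \<and> N \<in> carrier (GL 2) \<and> \<omega> \<in> hom (VL n) (GL n) \<and>
     (\<forall>i. 1 \<le> i \<and> i < n \<longrightarrow>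
        \<omega> (ell n i) = local_block n i M \<and> \<omega> (rho n i) = local_block n i N)"

definition nontrivial_homogeneous_2_local :: "nat \<Rightarrow> (vl_gen word set \<Rightarrow> complex mat) \<Rightarrow> bool" where
  "nontrivial_homogeneous_2_local n \<omega> \<longleftrightarrow>
     (\<exists>M N. homogeneous_2_local n M N \<omega> \<and> \<not> (M = 1\<^sub>m 2 \<and> N = 1\<^sub>m 2))"

text \<open>Homomorphisms are only determined on the carrier of \<open>VL n\<close>, so representations are
  compared there.\<close>

definition equivalent_reps ::
  "nat \<Rightarrow> (vl_gen word set \<Rightarrow> complex mat) \<Rightarrow> (vl_gen word set \<Rightarrow> complex mat) \<Rightarrow> bool" where
  "equivalent_reps n \<omega> \<omega>' \<longleftrightarrow>
     (\<exists>P \<in> carrier (GL n). \<forall>g \<in> carrier (VL n).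
        \<omega>' g = P \<otimes>\<^bsub>GL n\<^esub> \<omega> g \<otimes>\<^bsub>GL n\<^esub> inv\<^bsub>GL n\<^esub> P)"

definition defines_rep_of_WL :: "nat \<Rightarrow> (vl_gen word set \<Rightarrow> complex mat) \<Rightarrow> bool" where
  "defines_rep_of_WL n \<omega> \<longleftrightarrow>
     (\<exists>\<phi> \<in> hom (WL n) (GL n). \<forall>g \<in> carrier (VL n). \<omega> g = \<phi> (welded_kernel n #>\<^bsub>VL n\<^esub> g))"

definition antidiag :: "complex \<Rightarrow> complex mat" where
  "antidiag b = mat_of_rows_list 2 [[0, b], [1 / b, 0]]"

definition is_omega1 ::
  "nat \<Rightarrow> complex \<Rightarrow> complex \<Rightarrow> (vl_gen word set \<Rightarrow> complex mat) \<Rightarrow> bool" where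
  "is_omega1 n b x \<omega> \<longleftrightarrow>
     \<omega> \<in> hom (VL n) (GL n) \<and>
     (\<forall>i. 1 \<le> i \<and> i < n \<longrightarrow>
        \<omega> (ell n i) = local_block n i (antidiag b) \<and> \<omega> (rho n i) = local_block n i (antidiag x))"

definition is_omega2 :: "nat \<Rightarrow> complex \<Rightarrow> (vl_gen word set \<Rightarrow> complex mat) \<Rightarrow> bool" where
  "is_omega2 n x \<omega> \<longleftrightarrow>
     \<omega> \<in> hom (VL n) (GL n) \<and>
     (\<forall>i. 1 \<le> i \<and> i < n \<longrightarrow>
        \<omega> (ell n i) = 1\<^sub>m n \<and> \<omega> (rho n i) = local_block n i (antidiag x))"

end

theory Submission
  imports Defs
begin

text \<open>
  Everything happens in a window of three consecutive coordinates. A homogeneous 2-local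
  representation is given by two matrices \<open>M\<close> and \<open>N\<close>, and every defining relation of \<open>VL\<^sub>n\<close> involves
  a single block, two blocks with disjoint supports (which commute whatever \<open>M\<close> and \<open>N\<close> are), or
  the blocks at \<open>i\<close> and \<open>i + 1\<close>. The latter two blocks are the \<open>3 \<times> 3\<close> matrices \<open>diag(M, 1)\<close>
  and \<open>diag(1, M)\<close> padded by identities, and padding is injective and multiplicative. Hence the
  relations hold for all \<open>i\<close> exactly when \<open>M\<^sup>2 = N\<^sup>2 = 1\<close> and finitely many equations between
  \<open>3 \<times> 3\<close> matrices hold; for \<open>n \<ge> 3\<close> there is room for at least one such window.

  Reading off entries, an involution \<open>M\<close> with diagonal \<open>a, d\<close> and off-diagonal entries \<open>b, c\<close>
  that satisfies the braid relation has \<open>a (a + b c - 1) = 0\<close> besides \<open>a\<^sup>2 + b c = 1\<close>. So either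
  \<open>a = 0\<close>, and \<open>M\<close> is antidiagonal with \<open>b c = 1\<close>, or \<open>a = 1\<close>, and \<open>M = 1\<close>
  (\<open>involution_braid_cases\<close>). The same holds for \<open>N\<close>. The mixed relation
  \<open>\<rho>\<^sub>1 \<rho>\<^sub>2 \<ell>\<^sub>1 = \<ell>\<^sub>2 \<rho>\<^sub>1 \<rho>\<^sub>2\<close> turns \<open>N = 1\<close> into \<open>\<ell>\<^sub>1 = \<ell>\<^sub>2\<close>, which is impossible
  for an antidiagonal block, so the non-trivial representations are already equal to \<open>\<omega>\<^sub>1\<close> or
  \<open>\<omega>\<^sub>2\<close> and the conjugating matrix can be taken to be the identity.

  Conversely, padded antidiagonal blocks are monomial matrices, and a direct computation shows that
  they satisfy these relations for arbitrary non-zero parameters, as does \<open>M = 1\<close>. So the universal property of the presentation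
  (\<open>presented_group_universal\<close>) yields \<open>\<omega>\<^sub>1\<close> and \<open>\<omega>\<^sub>2\<close>. A homomorphism factors through the
  quotient by a normal closure exactly when it kills the relators
  (\<open>factors_through_normal_closure_iff\<close>), so being a representation of \<open>WL\<^sub>n\<close> is again an equation
  between \<open>3 \<times> 3\<close> matrices. It holds for \<open>\<omega>\<^sub>1\<close>, while for \<open>\<omega>\<^sub>2\<close> it says that \<open>\<rho>\<^sub>1\<close> and
  \<open>\<rho>\<^sub>2\<close> have the same image, which is false.
\<close>

section \<open>Homomorphisms out of a presented group\<close>

definition word_eval :: "('a, 'b) monoid_scheme \<Rightarrow> ('s \<Rightarrow> 'a) \<Rightarrow> 's word \<Rightarrow> 'a" where
  "word_eval G f w =
     foldr (\<lambda>(s, e) a. (if e then f s else inv\<^bsub>G\<^esub> f s) \<otimes>\<^bsub>G\<^esub> a) w \<one>\<^bsub>G\<^esub>"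

lemma word_eval_Nil [simp]: "word_eval G f [] = \<one>\<^bsub>G\<^esub>"
  and word_eval_Cons [simp]:
    "word_eval G f ((s, e) # w) = (if e then f s else inv\<^bsub>G\<^esub> f s) \<otimes>\<^bsub>G\<^esub> word_eval G f w"
  by (simp_all add: word_eval_def)

lemma (in group) word_eval_closed:
  assumes f: "f \<in> S \<rightarrow> carrier G" and w: "w \<in> words S"
  shows "word_eval G f w \<in> carrier G"
  using w by (induction w) (use f in \<open>auto simp: words_def Pi_iff\<close>)

lemma (in group) word_eval_append:
  assumes f: "f \<in> S \<rightarrow> carrier G" and u: "u \<in> words S" and v: "v \<in> words S"
  shows "word_eval G f (u @ v) = word_eval G f u \<otimes> word_eval G f v"
  using u
proof (induction u)
  case Nil
  then show ?case using word_eval_closed[OF f v] by simp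
next
  case (Cons a u)
  obtain s e where a: "a = (s, e)" by force
  have s: "s \<in> S" and u: "u \<in> words S" using Cons.prems by (auto simp: a words_def)
  have "f s \<in> carrier G" using f s by auto
  then show ?case
    using Cons.IH[OF u] word_eval_closed[OF f v] word_eval_closed[OF f u] by (simp add: a m_assoc)
qed

text \<open>The evaluations of words in a group form a congruence that contains the cancellation pairs, and
  \<open>pres_cong\<close> is the least congruence containing these and the relations.\<close>

lemma (in group) word_eval_pres_cong:
  assumes f: "f \<in> S \<rightarrow> carrier G"
    and R: "\<And>u v. (u, v) \<in> R \<Longrightarrow> u \<in> words S \<Longrightarrow> v \<in> words S \<Longrightarrow> word_eval G f u = word_eval G f v"
    and uv: "(u, v) \<in> pres_cong S R"
  shows "word_eval G f u = word_eval G f v"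
  using uv
proof (induction rule: pres_cong.induct)
  case (append u u' v v')
  then show ?case
    using pres_cong_words[OF append.hyps(1)] pres_cong_words[OF append.hyps(2)]
    by (simp add: word_eval_append[OF f])
next
  case (cancel s e)
  then have "f s \<in> carrier G" using f by auto
  then show ?case by simp
qed (use R in auto)

lemma pres_cong_class_eq_iff:
  assumes "u \<in> words S"
  shows "pres_cong S R `` {u} = pres_cong S R `` {v} \<longleftrightarrow> (u, v) \<in> pres_cong S R"
  using assms pres_cong_words[of u v S R]
  by (metis equiv_class_eq equiv_pres_cong eq_equiv_class equiv_class_self Image_singleton_iff
      pres_cong.refl pres_cong.sym)

text \<open>Von Dyck's theorem: evaluation is constant on the classes of \<open>pres_cong\<close>, hence it descends to the
  presented group.\<close>

lemma (in group) presented_group_universal: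
  assumes f: "f \<in> S \<rightarrow> carrier G"
    and R: "\<And>u v. (u, v) \<in> R \<Longrightarrow> u \<in> words S \<Longrightarrow> v \<in> words S \<Longrightarrow> word_eval G f u = word_eval G f v"
  obtains \<phi> where "\<phi> \<in> hom (presented_group S R) G"
    "\<And>s. s \<in> S \<Longrightarrow> \<phi> (pres_cong S R `` {[(s, True)]}) = f s"
proof
  let ?c = "\<lambda>w. pres_cong S R `` {w}"
  define \<phi> where "\<phi> = (\<lambda>C. word_eval G f (SOME w. w \<in> C))"
  have val: "\<phi> (?c w) = word_eval G f w" if w: "w \<in> words S" for w
  proof -
    have "w \<in> ?c w" using w by (simp add: pres_cong.refl)
    then have "(SOME w'. w' \<in> ?c w) \<in> ?c w" by (rule someI)
    then show ?thesis
      unfolding \<phi>_def using word_eval_pres_cong[OF f R] by fastforce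
  qed
  show "\<phi> \<in> hom (presented_group S R) G"
  proof (rule homI)
    fix x assume "x \<in> carrier (presented_group S R)"
    then show "\<phi> x \<in> carrier G"
      by (auto simp: presented_group_def val word_eval_closed[OF f] elim!: quotientE)
  next
    fix x y assume x: "x \<in> carrier (presented_group S R)" and y: "y \<in> carrier (presented_group S R)"
    obtain u v where u: "u \<in> words S" "x = ?c u" and v: "v \<in> words S" "y = ?c v"
      using x y by (auto simp: presented_group_def elim!: quotientE)
    have "u @ v \<in> words S" using u v by (simp add: words_def)
    then show "\<phi> (x \<otimes>\<^bsub>presented_group S R\<^esub> y) = \<phi> x \<otimes> \<phi> y"
      using u v by (simp add: presented_group_mult val word_eval_append[OF f])
  qed
  show "\<phi> (?c [(s, True)]) = f s" if "s \<in> S" for s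
  proof -
    have "f s \<in> carrier G" using f that by auto
    then show ?thesis using that by (simp add: val words_def)
  qed
qed

lemma presented_group_class_closed:
  "w \<in> words S \<Longrightarrow> pres_cong S R `` {w} \<in> carrier (presented_group S R)"
  by (simp add: presented_group_def quotientI)

lemma one_presented_group: "\<one>\<^bsub>presented_group S R\<^esub> = pres_cong S R `` {[]}"
  by (simp add: presented_group_def)

text \<open>This turns an equation in the presented group into an equation between the images of the
  generators.\<close>

lemma (in group) hom_presented_group_word:
  assumes \<phi>: "\<phi> \<in> hom (presented_group S R) G" and w: "w \<in> words S"
  shows "\<phi> (pres_cong S R `` {w}) = word_eval G (\<lambda>s. \<phi> (pres_cong S R `` {[(s, True)]})) w"
proof -
  let ?P = "presented_group S R" and ?c = "\<lambda>w. pres_cong S R `` {w}"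
  interpret \<phi>: group_hom ?P G \<phi>
    using \<phi> by (simp add: group_hom_def group_hom_axioms_def group_presented_group is_group)
  show ?thesis
    using w
  proof (induction w)
    case Nil
    then show ?case using \<phi>.hom_one by (simp add: presented_group_def)
  next
    case (Cons a w)
    obtain s e where a: "a = (s, e)" by force
    have s: "s \<in> S" and w: "w \<in> words S" using Cons.prems by (auto simp: a words_def)
    have l: "[(s, e)] \<in> words S" for e using s by (simp add: words_def)
    have "?c [(s, False)] \<otimes>\<^bsub>?P\<^esub> ?c [(s, True)] = \<one>\<^bsub>?P\<^esub>"
      using pres_cong.cancel[OF s, of False R] pres_cong_class_eq_iff[of "[(s, False), (s, True)]" S R "[]"] s
      by (simp add: presented_group_mult l one_presented_group words_def)
    then have "?c [(s, False)] = inv\<^bsub>?P\<^esub> ?c [(s, True)]"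
      using \<phi>.G.inv_equality presented_group_class_closed[OF l] by metis
    then have "\<phi> (?c [(s, e)]) = (if e then \<phi> (?c [(s, True)]) else inv \<phi> (?c [(s, True)]))"
      using presented_group_class_closed[OF l] by simp
    moreover have "\<phi> (?c (a # w)) = \<phi> (?c [(s, e)]) \<otimes> \<phi> (?c w)"
      using \<phi>.hom_mult[OF presented_group_class_closed[OF l] presented_group_class_closed[OF w]]
      by (simp add: presented_group_mult[OF l w] a)
    ultimately show ?case using Cons.IH[OF w] by (simp add: a)
  qed
qed

lemma (in group) hom_presented_group_relation:
  assumes \<phi>: "\<phi> \<in> hom (presented_group S R) G"
    and R: "(u, v) \<in> R" and u: "u \<in> words S" and v: "v \<in> words S"
  shows "word_eval G (\<lambda>s. \<phi> (pres_cong S R `` {[(s, True)]})) u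
    = word_eval G (\<lambda>s. \<phi> (pres_cong S R `` {[(s, True)]})) v"
proof -
  have "pres_cong S R `` {u} = pres_cong S R `` {v}"
    using pres_cong.rel[OF R u v] u by (simp add: pres_cong_class_eq_iff)
  then show ?thesis using u v by (simp flip: hom_presented_group_word[OF \<phi>])
qed

section \<open>Quotients by a normal closure\<close>

lemma (in group) normal_closure_normal:
  assumes "A \<subseteq> carrier G"
  shows "normal_closure G A \<lhd> G"
proof -
  let ?N = "{H. H \<lhd> G \<and> A \<subseteq> H}"
  have "carrier G \<in> ?N" using assms normal_invI[OF subgroup_self] by simp
  then have "subgroup (\<Inter>?N) G"
    by (intro subgroups_Inter) (auto dest: normal_imp_subgroup)
  then show ?thesis
    unfolding normal_closure_def
    by (rule normal_invI) (auto dest: normal_invE(2) simp: normal_inv_iff)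
qed

text \<open>The kernel of \<open>h\<close> is normal, so it contains the normal closure of \<open>A\<close> as soon as it contains \<open>A\<close>.\<close>

lemma (in group_hom) factors_through_normal_closure_iff:
  assumes A: "A \<subseteq> carrier G"
  shows "(\<exists>\<phi> \<in> hom (G Mod normal_closure G A) H. \<forall>g \<in> carrier G. h g = \<phi> (normal_closure G A #> g))
    \<longleftrightarrow> (\<forall>a \<in> A. h a = \<one>\<^bsub>H\<^esub>)"
proof
  let ?K = "normal_closure G A"
  have K: "?K \<lhd> G" by (rule G.normal_closure_normal[OF A])
  {
    assume "\<exists>\<phi> \<in> hom (G Mod ?K) H. \<forall>g \<in> carrier G. h g = \<phi> (?K #> g)"
    then obtain \<phi> where \<phi>: "\<And>g. g \<in> carrier G \<Longrightarrow> h g = \<phi> (?K #> g)" by auto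
    show "\<forall>a \<in> A. h a = \<one>\<^bsub>H\<^esub>"
    proof
      fix a assume a: "a \<in> A"
      have "a \<in> ?K" using a by (auto simp: normal_closure_def)
      then have "?K #> a = ?K #> \<one>"
        using normal_imp_subgroup[OF K] a A by (auto simp: G.coset_join2 subgroup.one_closed)
      then have "h a = h \<one>" using a A \<phi>[of a] \<phi>[of \<one>] by auto
      then show "h a = \<one>\<^bsub>H\<^esub>" by simp
    qed
  next
    assume "\<forall>a \<in> A. h a = \<one>\<^bsub>H\<^esub>"
    then have "?K \<subseteq> kernel G H h"
      using normal_kernel A by (auto simp: normal_closure_def kernel_def)
    from FactGroup_universal_kernel[OF K this]
    show "\<exists>\<phi> \<in> hom (G Mod ?K) H. \<forall>g \<in> carrier G. h g = \<phi> (?K #> g)" by metis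
  }
qed

section \<open>Matrices acting on a window of consecutive coordinates\<close>

text \<open>\<open>pad_block n k A\<close> is the block diagonal matrix \<open>diag(1\<^sub>k, A, 1)\<close> of size \<open>n\<close>. Giving its entries
  by one formula lets a block be padded in two steps (\<open>pad_block_pad_block\<close>) and avoids the nested
  offsets of \<open>diag_block_mat\<close>.\<close>

definition pad_block :: "nat \<Rightarrow> nat \<Rightarrow> 'a :: semiring_1 mat \<Rightarrow> 'a mat" where
  "pad_block n k A = mat n n (\<lambda>(r, s).
     if r \<in> {k..<k + dim_row A} \<and> s \<in> {k..<k + dim_row A} then A $$ (r - k, s - k)
     else if r = s then 1 else 0)"

lemma pad_block_carrier [simp]: "pad_block n k A \<in> carrier_mat n n"
  and pad_block_dim [simp]: "dim_row (pad_block n k A) = n" "dim_col (pad_block n k A) = n"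
  by (simp_all add: pad_block_def)

lemma pad_block_index:
  "r < n \<Longrightarrow> s < n \<Longrightarrow> pad_block n k A $$ (r, s) =
    (if r \<in> {k..<k + dim_row A} \<and> s \<in> {k..<k + dim_row A} then A $$ (r - k, s - k)
     else if r = s then 1 else 0)"
  by (simp add: pad_block_def)

lemma pad_block_one [simp]: "pad_block n k (1\<^sub>m d) = 1\<^sub>m n"
  by (rule eq_matI) (auto simp: pad_block_index)

lemma pad_block_pad_block:
  assumes "A \<in> carrier_mat d d" "j + d \<le> m" "k + m \<le> n"
  shows "pad_block n k (pad_block m j A) = pad_block n (k + j) A"
  using assms by (intro eq_matI) (auto simp: pad_block_index)

lemma pad_block_inject:
  assumes "A \<in> carrier_mat d d" "B \<in> carrier_mat d d" "k + d \<le> n"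
  shows "pad_block n k A = pad_block n k B \<longleftrightarrow> A = B"
proof
  assume eq: "pad_block n k A = pad_block n k B"
  show "A = B"
  proof (rule eq_matI)
    fix r s assume "r < dim_row B" "s < dim_col B"
    then show "A $$ (r, s) = B $$ (r, s)"
      using arg_cong[OF eq, of "\<lambda>X. X $$ (k + r, k + s)"] assms by (simp add: pad_block_index)
  qed (use assms in auto)
qed simp

text \<open>A row outside the window is a row of the identity matrix.\<close>

lemma pad_block_mult_index_outside:
  assumes "X \<in> carrier_mat n n" "r < n" "s < n" "r \<notin> {k..<k + dim_row A}"
  shows "(pad_block n k A * X) $$ (r, s) = X $$ (r, s)"
proof -
  have "(pad_block n k A * X) $$ (r, s) = (\<Sum>t = 0..<n. pad_block n k A $$ (r, t) * X $$ (t, s))"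
    using assms by (simp add: scalar_prod_def)
  also have "\<dots> = (\<Sum>t = 0..<n. if t = r then X $$ (t, s) else 0)"
    using assms by (intro sum.cong) (auto simp: pad_block_index)
  finally show ?thesis using assms by simp
qed

lemma pad_block_mult:
  assumes A: "A \<in> carrier_mat d d" and B: "B \<in> carrier_mat d d" and k: "k + d \<le> n"
  shows "pad_block n k A * pad_block n k B = pad_block n k (A * B)"
proof (rule eq_matI)
  fix r s assume "r < dim_row (pad_block n k (A * B))" "s < dim_col (pad_block n k (A * B))"
  then have rs: "r < n" "s < n" by simp_all
  show "(pad_block n k A * pad_block n k B) $$ (r, s) = pad_block n k (A * B) $$ (r, s)"
  proof (cases "r \<in> {k..<k + d}")
    case False
    then show ?thesis
      using A B rs by (subst pad_block_mult_index_outside) (auto simp: pad_block_index simp del: index_mult_mat(1))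
  next
    case r: True
    have "(pad_block n k A * pad_block n k B) $$ (r, s)
        = (\<Sum>t = 0..<n. pad_block n k A $$ (r, t) * pad_block n k B $$ (t, s))"
      using rs by (simp add: scalar_prod_def)
    also have "\<dots> = (\<Sum>t = k..<k + d. A $$ (r - k, t - k) * pad_block n k B $$ (t, s))"
      using rs r A k by (intro sum.mono_neutral_cong_right) (auto simp: pad_block_index)
    also have "\<dots> = (\<Sum>t = 0..<d. A $$ (r - k, t) * pad_block n k B $$ (k + t, s))"
      using sum.shift_bounds_nat_ivl[of "\<lambda>t. A $$ (r - k, t - k) * pad_block n k B $$ (t, s)" 0 k d]
      by (simp add: add.commute)
    also have "\<dots> = pad_block n k (A * B) $$ (r, s)"
      using rs r A B k by (auto simp: pad_block_index scalar_prod_def intro!: sum.cong sum.neutral)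
    finally show ?thesis .
  qed
qed (use A B in auto)

lemma pad_block_triple_eq_iff:
  assumes "A \<in> carrier_mat d d" "B \<in> carrier_mat d d" "C \<in> carrier_mat d d"
    and "D \<in> carrier_mat d d" "E \<in> carrier_mat d d" "F \<in> carrier_mat d d" and "k + d \<le> n"
  shows "pad_block n k A * (pad_block n k B * pad_block n k C)
      = pad_block n k D * (pad_block n k E * pad_block n k F)
    \<longleftrightarrow> A * (B * C) = D * (E * F)"
proof -
  have BC: "B * C \<in> carrier_mat d d" and EF: "E * F \<in> carrier_mat d d" using assms by auto
  have "A * (B * C) \<in> carrier_mat d d" "D * (E * F) \<in> carrier_mat d d"
    using mult_carrier_mat[OF assms(1) BC] mult_carrier_mat[OF assms(4) EF] .
  then show ?thesis
    using assms BC EF by (simp add: pad_block_mult[of _ d] pad_block_inject[of _ d])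
qed

lemma pad_block_commute:
  assumes A: "A \<in> carrier_mat d d" and B: "B \<in> carrier_mat e e" and disj: "k + d \<le> l \<or> l + e \<le> k"
  shows "pad_block n k A * pad_block n l B = pad_block n l B * pad_block n k A"
proof -
  \<comment> \<open>The nonzero entries of a row in the window of the first factor lie in that window, where
    the second factor acts as the identity. So in either order the product has the rows of each
    matrix inside its own window and rows of the identity elsewhere.\<close>
  have row: "(pad_block n k A * pad_block n l B) $$ (r, s) = pad_block n k A $$ (r, s)"
    if A: "A \<in> carrier_mat d d" and B: "B \<in> carrier_mat e e" and disj: "k + d \<le> l \<or> l + e \<le> k"
      and rs: "r < n" "s < n" and r: "r \<in> {k..<k + d}"
    for A B :: "'a mat" and d e k l r s
  proof -
    have "(pad_block n k A * pad_block n l B) $$ (r, s)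
        = (\<Sum>t = 0..<n. pad_block n k A $$ (r, t) * pad_block n l B $$ (t, s))"
      using rs by (simp add: scalar_prod_def)
    also have "\<dots> = (\<Sum>t = 0..<n. if t = s then pad_block n k A $$ (r, t) else 0)"
      using rs r A B disj by (intro sum.cong) (auto simp: pad_block_index)
    finally show ?thesis using rs by simp
  qed
  show ?thesis
  proof (rule eq_matI)
    fix r s assume "r < dim_row (pad_block n l B * pad_block n k A)"
      "s < dim_col (pad_block n l B * pad_block n k A)"
    then have rs: "r < n" "s < n" by simp_all
    consider "r \<in> {k..<k + d}" | "r \<in> {l..<l + e}" | "r \<notin> {k..<k + d}" "r \<notin> {l..<l + e}" by blast
    then show "(pad_block n k A * pad_block n l B) $$ (r, s) = (pad_block n l B * pad_block n k A) $$ (r, s)"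
    proof cases
      case 1
      then have "r \<notin> {l..<l + e}" using disj by auto
      then show ?thesis using row[OF A B disj rs 1] A B rs by (simp add: pad_block_mult_index_outside del: index_mult_mat(1))
    next
      case 2
      then have "r \<notin> {k..<k + d}" using disj by auto
      then show ?thesis using row[OF B A disj[THEN disj_commute[THEN iffD1]] rs 2] A B rs by (simp add: pad_block_mult_index_outside del: index_mult_mat(1))
    next
      case 3
      then show ?thesis using A B rs
        by (auto simp: pad_block_mult_index_outside pad_block_index simp del: index_mult_mat(1))
    qed
  qed auto
qed

lemma local_block_eq_pad_block:
  assumes "M \<in> carrier_mat 2 2" "1 \<le> i" "i < n"
  shows "local_block n i M = pad_block n (i - 1) M"
proof -
  \<comment> \<open>Writing \<open>n = k + 2 + m\<close> removes all truncated subtractions from the block sizes.\<close>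
  obtain k m where i: "i = k + 1" and n: "n = k + 2 + m"
    using assms by (metis add.commute le_Suc_ex less_eq_Suc_le add.assoc Suc_1 plus_1_eq_Suc add_Suc_right)
  have M: "dim_row M = 2" "dim_col M = 2" using assms by auto
  show ?thesis
    unfolding i n
  proof (rule eq_matI)
    fix r s assume "r < dim_row (pad_block (k + 2 + m) (k + 1 - 1) M)"
      "s < dim_col (pad_block (k + 2 + m) (k + 1 - 1) M)"
    then have rs: "r < k + 2 + m" "s < k + 2 + m" by simp_all
    show "local_block (k + 2 + m) (k + 1) M $$ (r, s) = pad_block (k + 2 + m) (k + 1 - 1) M $$ (r, s)"
      using rs M unfolding local_block_def diag_block_mat.simps Let_def
      by (cases "r < k"; cases "r < k + 2"; cases "s < k"; cases "s < k + 2")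
        (simp_all add: pad_block_index less_diff_conv2 eq_diff_iff)
  qed (simp_all add: local_block_def Let_def M)
qed

text \<open>The blocks at \<open>i\<close> and \<open>i + 1\<close> lie in the common window of the coordinates \<open>i - 1, i, i + 1\<close>
  (counted from \<open>0\<close>), where they occupy the first two and the last two coordinates.\<close>

lemma local_block_adjacent:
  assumes "M \<in> carrier_mat 2 2" "1 \<le> i" "i + 1 < n"
  shows "local_block n i M = pad_block n (i - 1) (pad_block 3 0 M)"
    and "local_block n (i + 1) M = pad_block n (i - 1) (pad_block 3 1 M)"
  using assms by (simp_all add: local_block_eq_pad_block pad_block_pad_block)

section \<open>Braid-type relations between two adjacent blocks\<close>

lemma mult_index_3:
  fixes A B :: "'a :: comm_semiring_1 mat"
  assumes "dim_col A = 3" "dim_row B = 3" "r < dim_row A" "s < dim_col B"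
  shows "(A * B) $$ (r, s) = A $$ (r, 0) * B $$ (0, s) + A $$ (r, 1) * B $$ (1, s) + A $$ (r, 2) * B $$ (2, s)"
  using assms by (simp add: scalar_prod_def numeral_3_eq_3 numeral_2_eq_2)

lemma mult_index_2:
  fixes A B :: "'a :: comm_semiring_1 mat"
  assumes "dim_col A = 2" "dim_row B = 2" "r < dim_row A" "s < dim_col B"
  shows "(A * B) $$ (r, s) = A $$ (r, 0) * B $$ (0, s) + A $$ (r, 1) * B $$ (1, s)"
  using assms by (simp add: scalar_prod_def numeral_2_eq_2)

lemma mat_eq_iff_2:
  assumes "dim_row A = 2" "dim_col A = 2" "dim_row B = 2" "dim_col B = 2"
  shows "A = B \<longleftrightarrow> A $$ (0, 0) = B $$ (0, 0) \<and> A $$ (0, 1) = B $$ (0, 1)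
    \<and> A $$ (1, 0) = B $$ (1, 0) \<and> A $$ (1, 1) = B $$ (1, 1)"
  using assms by (auto intro!: eq_matI simp: less_2_cases_iff)

lemma mat_eq_3I:
  assumes "dim_row A = 3" "dim_col A = 3" "dim_row B = 3" "dim_col B = 3"
    and eq: "\<forall>r \<in> {0, 1, 2}. \<forall>s \<in> {0, 1, 2}. A $$ (r, s) = B $$ (r, s)"
  shows "A = B"
proof (rule eq_matI)
  fix r s assume "r < dim_row B" "s < dim_col B"
  then have "r < 3" "s < 3" using assms(1-4) by simp_all
  then have "r \<in> {0, 1, 2}" "s \<in> {0, 1, 2}" by auto
  then show "A $$ (r, s) = B $$ (r, s)" using eq by blast
qed (use assms(1-4) in simp_all)

lemma antidiag_carrier [simp]: "antidiag b \<in> carrier_mat 2 2"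
  by (simp add: antidiag_def mat_of_rows_list_def numeral_2_eq_2)

lemma antidiag_dim [simp]: "dim_row (antidiag b) = 2" "dim_col (antidiag b) = 2"
  by (simp_all add: antidiag_def mat_of_rows_list_def)

lemma antidiag_index [simp]:
  "antidiag b $$ (0, 0) = 0" "antidiag b $$ (0, Suc 0) = b"
  "antidiag b $$ (Suc 0, 0) = 1 / b" "antidiag b $$ (Suc 0, Suc 0) = 0"
  by (simp_all add: antidiag_def mat_of_rows_list_def)

lemma antidiag_involution: "b \<noteq> 0 \<Longrightarrow> antidiag b * antidiag b = 1\<^sub>m 2"
  by (subst mat_eq_iff_2) (simp_all add: mult_index_2 del: index_mult_mat(1))

text \<open>With \<open>M\<^sup>2 = 1\<close>, four entries of the braid relation suffice. If \<open>a = 0\<close>, then \<open>b c = 1\<close> and \<open>d = 0\<close>; if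
  \<open>a \<noteq> 0\<close>, then \<open>a + b c = 1 = a\<^sup>2 + b c\<close> forces \<open>a = 1\<close>, then \<open>d = 1\<close>, and finally the entries
  \<open>a b d\<close> and \<open>a c d\<close> force \<open>b = c = 0\<close>.\<close>

lemma involution_braid_cases:
  assumes M: "M \<in> carrier_mat 2 2" and inv: "M * M = 1\<^sub>m 2"
    and braid: "pad_block 3 0 M * (pad_block 3 1 M * pad_block 3 0 M)
      = pad_block 3 1 M * (pad_block 3 0 M * pad_block 3 1 M)"
  shows "M = 1\<^sub>m 2 \<or> (\<exists>b. b \<noteq> 0 \<and> M = antidiag b)"
proof -
  define a b c d where abcd: "a = M $$ (0, 0)" "b = M $$ (0, 1)" "c = M $$ (1, 0)" "d = M $$ (1, 1)"
  have sq: "a * a + b * c = 1" "c * b + d * d = 1"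
    using inv M mat_eq_iff_2[of "M * M" "1\<^sub>m 2"]
    by (simp_all add: mult_index_2 abcd del: index_mult_mat(1))
  have entry: "(pad_block 3 0 M * (pad_block 3 1 M * pad_block 3 0 M)) $$ (r, s)
      = (pad_block 3 1 M * (pad_block 3 0 M * pad_block 3 1 M)) $$ (r, s)" for r s
    by (simp only: braid)
  have e00: "a * a + b * a * c = a"
    using entry[of 0 0] M
    by (simp add: mult_index_3 pad_block_index abcd algebra_simps del: index_mult_mat(1))
  have e22: "d = b * c * d + d * d"
    using entry[of 2 2] M
    by (simp add: mult_index_3 pad_block_index abcd algebra_simps del: index_mult_mat(1))
  have e01: "a * b * d = 0"
    using entry[of 0 1] M
    by (simp add: mult_index_3 pad_block_index abcd algebra_simps del: index_mult_mat(1))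
  have e10: "a * c * d = 0"
    using entry[of 1 0] M
    by (simp add: mult_index_3 pad_block_index abcd algebra_simps del: index_mult_mat(1))
  show ?thesis
  proof (cases "a = 0")
    case True
    then have bc: "b * c = 1" using sq by simp
    then have "d = 0" using sq by (simp add: mult.commute)
    moreover have "b \<noteq> 0" using bc by auto
    moreover from this have "c = 1 / b" using bc by (simp add: field_simps)
    ultimately have "M = antidiag b"
      using True M by (simp add: mat_eq_iff_2 abcd)
    then show ?thesis using \<open>b \<noteq> 0\<close> by blast
  next
    case False
    have "a * (a + b * c - 1) = 0" using e00 by (simp add: algebra_simps)
    then have "a + b * c = 1" using False by auto
    then have "a * (a - 1) = (a * a + b * c) - (a + b * c)" by (simp add: algebra_simps)
    then have "a * (a - 1) = 0" using \<open>a + b * c = 1\<close> sq(1) by simp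
    then have a: "a = 1" using False by simp
    then have bc: "b * c = 0" using sq(1) by simp
    then have "d * d = 1" using sq(2) by (auto simp: mult.commute)
    then have d: "d = 1" using e22 bc by simp
    then show ?thesis using e01 e10 a M by (simp add: mat_eq_iff_2 abcd)
  qed
qed

text \<open>Both sides are the monomial matrix of the transposition of the outer coordinates, with entries
  \<open>x\<^sup>2\<close>, \<open>b / x\<close> and \<open>1 / (b x)\<close>. For \<open>b = x\<close> this is the ordinary braid relation.\<close>

lemma antidiag_mixed_braid:
  assumes "b \<noteq> 0" "x \<noteq> 0"
  shows "pad_block 3 0 (antidiag x) * (pad_block 3 1 (antidiag x) * pad_block 3 0 (antidiag b))
    = pad_block 3 1 (antidiag b) * (pad_block 3 0 (antidiag x) * pad_block 3 1 (antidiag x))"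
  by (rule mat_eq_3I)
    (use assms in \<open>simp_all add: mult_index_3 pad_block_index del: index_mult_mat(1)\<close>)

lemma antidiag_welded:
  assumes "b \<noteq> 0" "x \<noteq> 0"
  shows "pad_block 3 0 (antidiag x) * (pad_block 3 1 (antidiag b) * pad_block 3 0 (antidiag b))
    = pad_block 3 1 (antidiag b) * (pad_block 3 0 (antidiag b) * pad_block 3 1 (antidiag x))"
  by (rule mat_eq_3I)
    (use assms in \<open>simp_all add: mult_index_3 pad_block_index del: index_mult_mat(1)\<close>)

text \<open>The first coordinate is moved by the block on the left but fixed by the block on the right.\<close>

lemma pad_block_antidiag_shift_neq: "pad_block 3 0 (antidiag x) \<noteq> pad_block 3 1 (antidiag x)"
proof
  assume "pad_block 3 0 (antidiag x) = pad_block 3 1 (antidiag x)"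
  then have "pad_block 3 0 (antidiag x) $$ (0, 0) = pad_block 3 1 (antidiag x) $$ (0, 0)" by simp
  then show False by (simp add: pad_block_index)
qed

section \<open>Local representations of the virtual triplet group\<close>

lemma GL_simps:
  "mult (GL n) = (*)" "one (GL n) = 1\<^sub>m n"
  by (simp_all add: GL_def units_of_def ring_mat_def)

lemma group_GL: "group (GL n)"
proof -
  interpret ring "ring_mat TYPE(complex) n ()" by (rule ring_mat)
  show ?thesis unfolding GL_def by (rule units_group)
qed

lemma GL_carrier_mat: "A \<in> carrier (GL n) \<Longrightarrow> A \<in> carrier_mat n n"
  by (auto simp: GL_def units_of_def Units_def ring_mat_def)

lemma involution_in_GL: "A \<in> carrier_mat n n \<Longrightarrow> A * A = 1\<^sub>m n \<Longrightarrow> A \<in> carrier (GL n)"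
  by (auto simp: GL_def units_of_def Units_def ring_mat_def)

lemma group_VL: "group (VL n)"
  by (simp add: VL_def group_presented_group)

lemma ell_closed: "1 \<le> i \<Longrightarrow> i < n \<Longrightarrow> ell n i \<in> carrier (VL n)"
  and rho_closed: "1 \<le> i \<Longrightarrow> i < n \<Longrightarrow> rho n i \<in> carrier (VL n)"
  unfolding ell_def rho_def VL_def
  by (rule presented_group_class_closed; simp add: words_def VL_gens_def)+

lemma local_block_carrier:
  assumes "M \<in> carrier_mat 2 2" "1 \<le> i" "i < n"
  shows "local_block n i M \<in> carrier_mat n n"
  using assms by (simp add: local_block_eq_pad_block)

lemma local_block_one: "1 \<le> i \<Longrightarrow> i < n \<Longrightarrow> local_block n i (1\<^sub>m 2) = 1\<^sub>m n"
  by (simp add: local_block_eq_pad_block)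

lemma local_block_involution_iff:
  assumes "M \<in> carrier_mat 2 2" "1 \<le> i" "i < n"
  shows "local_block n i M * local_block n i M = 1\<^sub>m n \<longleftrightarrow> M * M = 1\<^sub>m 2"
proof -
  have "local_block n i M * local_block n i M = pad_block n (i - 1) (M * M)"
    using assms by (simp add: local_block_eq_pad_block pad_block_mult[of _ 2])
  moreover have "1\<^sub>m n = pad_block n (i - 1) (1\<^sub>m 2)" by simp
  moreover have "pad_block n (i - 1) (M * M) = pad_block n (i - 1) (1\<^sub>m 2) \<longleftrightarrow> M * M = 1\<^sub>m 2"
    using assms by (intro pad_block_inject[of _ 2]) auto
  ultimately show ?thesis by metis
qed

lemma local_block_far_commute:
  assumes "M \<in> carrier_mat 2 2" "N \<in> carrier_mat 2 2"
    and "1 \<le> i" "i < n" "1 \<le> j" "j < n" "\<bar>int i - int j\<bar> \<ge> 2"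
  shows "local_block n i M * local_block n j N = local_block n j N * local_block n i M"
proof -
  have "(i - 1) + 2 \<le> j - 1 \<or> (j - 1) + 2 \<le> i - 1" using assms(3-7) by linarith
  from pad_block_commute[OF assms(1,2) this]
  show ?thesis using assms(1-6) by (simp add: local_block_eq_pad_block)
qed

text \<open>A relation of length three in the blocks at \<open>i\<close> and \<open>i + 1\<close> does not depend on \<open>n\<close> and \<open>i\<close>. The
  offsets \<open>p, q, r\<close> and \<open>s, t, u\<close> say which of the two positions each factor occupies.\<close>

lemma local_block_adjacent_relation_iff:
  assumes "1 \<le> i" "i + 1 < n" "A \<in> carrier_mat 2 2" "B \<in> carrier_mat 2 2" "C \<in> carrier_mat 2 2"
    and "D \<in> carrier_mat 2 2" "E \<in> carrier_mat 2 2" "F \<in> carrier_mat 2 2"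
    and "p \<in> {0, 1}" "q \<in> {0, 1}" "r \<in> {0, 1}" "s \<in> {0, 1}" "t \<in> {0, 1}" "u \<in> {0, 1}"
  shows "local_block n (i + p) A * (local_block n (i + q) B * local_block n (i + r) C)
      = local_block n (i + s) D * (local_block n (i + t) E * local_block n (i + u) F)
    \<longleftrightarrow> pad_block 3 p A * (pad_block 3 q B * pad_block 3 r C)
      = pad_block 3 s D * (pad_block 3 t E * pad_block 3 u F)"
proof -
  have window: "local_block n (i + p) A = pad_block n (i - 1) (pad_block 3 p A)"
    if "A \<in> carrier_mat 2 2" "p \<in> {0, 1}" for A p
    using that assms(1,2) local_block_adjacent[OF that(1) assms(1,2)] by auto
  have "(i - 1) + 3 \<le> n" using assms(1,2) by simp
  then show ?thesis
    unfolding window[OF assms(3) assms(9)] window[OF assms(4) assms(10)] window[OF assms(5) assms(11)]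
      window[OF assms(6) assms(12)] window[OF assms(7) assms(13)] window[OF assms(8) assms(14)]
    by (intro pad_block_triple_eq_iff[of _ 3]) simp_all
qed

text \<open>By the universal property only the relations have to be checked; those between distant generators
  hold automatically.\<close>

lemma VL_local_rep_exists:
  assumes M: "M \<in> carrier_mat 2 2" "M * M = 1\<^sub>m 2" and N: "N \<in> carrier_mat 2 2" "N * N = 1\<^sub>m 2"
    and braid_M: "pad_block 3 0 M * (pad_block 3 1 M * pad_block 3 0 M)
      = pad_block 3 1 M * (pad_block 3 0 M * pad_block 3 1 M)"
    and braid_N: "pad_block 3 0 N * (pad_block 3 1 N * pad_block 3 0 N)
      = pad_block 3 1 N * (pad_block 3 0 N * pad_block 3 1 N)"
    and mixed: "pad_block 3 0 N * (pad_block 3 1 N * pad_block 3 0 M)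
      = pad_block 3 1 M * (pad_block 3 0 N * pad_block 3 1 N)"
  obtains \<omega> where "\<omega> \<in> hom (VL n) (GL n)"
    "\<And>i. 1 \<le> i \<Longrightarrow> i < n \<Longrightarrow> \<omega> (ell n i) = local_block n i M"
    "\<And>i. 1 \<le> i \<Longrightarrow> i < n \<Longrightarrow> \<omega> (rho n i) = local_block n i N"
proof -
  let ?f = "case_vl_gen (\<lambda>i. local_block n i M) (\<lambda>i. local_block n i N)"
  note car = local_block_carrier[OF M(1)] local_block_carrier[OF N(1)]
  have sq: "local_block n i M * local_block n i M = 1\<^sub>m n" "local_block n i N * local_block n i N = 1\<^sub>m n"
    if "1 \<le> i" "i < n" for i
    using that M N by (simp_all add: local_block_involution_iff)
  have f: "?f \<in> VL_gens n \<rightarrow> carrier (GL n)"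
    using car sq by (auto simp: VL_gens_def intro!: involution_in_GL)
  have rels: "word_eval (GL n) ?f u = word_eval (GL n) ?f v" if "(u, v) \<in> VL_rels n" for u v
  proof -
    have adj: "local_block n i M * (local_block n (i + 1) M * local_block n i M)
        = local_block n (i + 1) M * (local_block n i M * local_block n (i + 1) M)"
      "local_block n i N * (local_block n (i + 1) N * local_block n i N)
        = local_block n (i + 1) N * (local_block n i N * local_block n (i + 1) N)"
      "local_block n i N * (local_block n (i + 1) N * local_block n i M)
        = local_block n (i + 1) M * (local_block n i N * local_block n (i + 1) N)"
      if "1 \<le> i" "i + 1 < n" for i
      using local_block_adjacent_relation_iff[OF that M(1) M(1) M(1) M(1) M(1) M(1), of 0 1 0 1 0 1]
        local_block_adjacent_relation_iff[OF that N(1) N(1) N(1) N(1) N(1) N(1), of 0 1 0 1 0 1]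
        local_block_adjacent_relation_iff[OF that N(1) N(1) M(1) M(1) N(1) N(1), of 0 1 0 1 0 1]
        braid_M braid_N mixed
      by simp_all
    note far = local_block_far_commute[OF N(1) N(1)] local_block_far_commute[OF M(1) N(1)]
    note one = right_mult_one_mat[OF car(1)] right_mult_one_mat[OF car(2)]
    show ?thesis
      using that unfolding VL_rels_def
      by (elim UnE CollectE exE conjE) (simp_all add: GL_simps one sq adj[simplified] far)
  qed
  from group.presented_group_universal[OF group_GL f rels]
  obtain \<omega> where \<omega>: "\<omega> \<in> hom (VL n) (GL n)"
    and gen: "\<And>s. s \<in> VL_gens n \<Longrightarrow> \<omega> (pres_cong (VL_gens n) (VL_rels n) `` {[(s, True)]}) = ?f s"
    unfolding VL_def by blast
  show thesis
  proof (rule that[OF \<omega>])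
    fix i assume "1 \<le> i" "i < n"
    then have "Ell i \<in> VL_gens n" "Rho i \<in> VL_gens n" by (auto simp: VL_gens_def)
    then show "\<omega> (ell n i) = local_block n i M" "\<omega> (rho n i) = local_block n i N"
      by (simp_all add: ell_def rho_def gen)
  qed
qed

text \<open>Since \<open>n \<ge> 3\<close>, the generators with indices \<open>1\<close> and \<open>2\<close> exist and their relations give the
  equations between \<open>3 \<times> 3\<close> matrices.\<close>

lemma homogeneous_2_local_relations:
  assumes n: "n \<ge> 3" and \<omega>: "homogeneous_2_local n M N \<omega>"
  shows "M * M = 1\<^sub>m 2" "N * N = 1\<^sub>m 2"
    and "pad_block 3 0 M * (pad_block 3 1 M * pad_block 3 0 M)
      = pad_block 3 1 M * (pad_block 3 0 M * pad_block 3 1 M)"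
    and "pad_block 3 0 N * (pad_block 3 1 N * pad_block 3 0 N)
      = pad_block 3 1 N * (pad_block 3 0 N * pad_block 3 1 N)"
    and "pad_block 3 0 N * (pad_block 3 1 N * pad_block 3 0 M)
      = pad_block 3 1 M * (pad_block 3 0 N * pad_block 3 1 N)"
proof -
  have M: "M \<in> carrier_mat 2 2" and N: "N \<in> carrier_mat 2 2"
    and hom: "\<omega> \<in> hom (presented_group (VL_gens n) (VL_rels n)) (GL n)"
    and val: "\<And>i. 1 \<le> i \<Longrightarrow> i < n \<Longrightarrow> \<omega> (ell n i) = local_block n i M"
      "\<And>i. 1 \<le> i \<Longrightarrow> i < n \<Longrightarrow> \<omega> (rho n i) = local_block n i N"
    using \<omega> by (auto simp: homogeneous_2_local_def GL_carrier_mat VL_def)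
  have gens: "Ell 1 \<in> VL_gens n" "Ell 2 \<in> VL_gens n" "Rho 1 \<in> VL_gens n" "Rho 2 \<in> VL_gens n"
    using n by (auto simp: VL_gens_def)
  have rel: "word_eval (GL n) (\<lambda>s. \<omega> (pres_cong (VL_gens n) (VL_rels n) `` {[(s, True)]})) u
      = word_eval (GL n) (\<lambda>s. \<omega> (pres_cong (VL_gens n) (VL_rels n) `` {[(s, True)]})) v"
    if "(u, v) \<in> VL_rels n" "set u \<union> set v \<subseteq> {Ell 1, Ell 2, Rho 1, Rho 2} \<times> UNIV" for u v
    using group.hom_presented_group_relation[OF group_GL hom that(1)] that(2) gens
    by (auto simp: words_def in_lists_conv_set)
  have ev: "\<omega> (pres_cong (VL_gens n) (VL_rels n) `` {l_word 1}) = local_block n 1 M"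
    "\<omega> (pres_cong (VL_gens n) (VL_rels n) `` {l_word 2}) = local_block n (1 + 1) M"
    "\<omega> (pres_cong (VL_gens n) (VL_rels n) `` {r_word 1}) = local_block n 1 N"
    "\<omega> (pres_cong (VL_gens n) (VL_rels n) `` {r_word 2}) = local_block n (1 + 1) N"
    using val[of 1] val[of 2] n by (simp_all add: ell_def rho_def numeral_2_eq_2)
  have car: "local_block n 1 M \<in> carrier_mat n n" "local_block n (1 + 1) M \<in> carrier_mat n n"
    "local_block n 1 N \<in> carrier_mat n n" "local_block n (1 + 1) N \<in> carrier_mat n n"
    using n M N by (simp_all add: local_block_carrier)
  note one = car[THEN right_mult_one_mat]
  have "(l_word 1 @ l_word 1, []) \<in> VL_rels n" "(r_word 1 @ r_word 1, []) \<in> VL_rels n"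
    using n by (auto simp: VL_rels_def)
  from this[THEN rel]
  have sq: "local_block n 1 M * local_block n 1 M = 1\<^sub>m n" "local_block n 1 N * local_block n 1 N = 1\<^sub>m n"
    by (simp_all add: GL_simps ev[simplified] one[simplified])
  then show "M * M = 1\<^sub>m 2" "N * N = 1\<^sub>m 2"
    using n M N by (simp_all add: local_block_involution_iff)
  have "(l_word 1 @ l_word 2 @ l_word 1, l_word 2 @ l_word 1 @ l_word 2) \<in> VL_rels n"
    "(r_word 1 @ r_word 2 @ r_word 1, r_word 2 @ r_word 1 @ r_word 2) \<in> VL_rels n"
    "(r_word 1 @ r_word 2 @ l_word 1, l_word 2 @ r_word 1 @ r_word 2) \<in> VL_rels n"
    using n by (auto simp: VL_rels_def)
  from this[THEN rel]
  have "local_block n 1 M * (local_block n (1 + 1) M * local_block n 1 M)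
      = local_block n (1 + 1) M * (local_block n 1 M * local_block n (1 + 1) M)"
    "local_block n 1 N * (local_block n (1 + 1) N * local_block n 1 N)
      = local_block n (1 + 1) N * (local_block n 1 N * local_block n (1 + 1) N)"
    "local_block n 1 N * (local_block n (1 + 1) N * local_block n 1 M)
      = local_block n (1 + 1) M * (local_block n 1 N * local_block n (1 + 1) N)"
    by (simp_all add: GL_simps ev[simplified] one[simplified])
  then show "pad_block 3 0 M * (pad_block 3 1 M * pad_block 3 0 M)
      = pad_block 3 1 M * (pad_block 3 0 M * pad_block 3 1 M)"
    "pad_block 3 0 N * (pad_block 3 1 N * pad_block 3 0 N)
      = pad_block 3 1 N * (pad_block 3 0 N * pad_block 3 1 N)"
    "pad_block 3 0 N * (pad_block 3 1 N * pad_block 3 0 M)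
      = pad_block 3 1 M * (pad_block 3 0 N * pad_block 3 1 N)"
    using local_block_adjacent_relation_iff[of 1 n M M M M M M 0 1 0 1 0 1]
      local_block_adjacent_relation_iff[of 1 n N N N N N N 0 1 0 1 0 1]
      local_block_adjacent_relation_iff[of 1 n N N M M N N 0 1 0 1 0 1] n M N
    by simp_all
qed

lemma homogeneous_2_local_cases:
  assumes n: "n \<ge> 3" and \<omega>: "homogeneous_2_local n M N \<omega>"
  obtains "M = 1\<^sub>m 2" "N = 1\<^sub>m 2"
    | x where "x \<noteq> 0" "M = 1\<^sub>m 2" "N = antidiag x"
    | b x where "b \<noteq> 0" "x \<noteq> 0" "M = antidiag b" "N = antidiag x"
proof -
  note rels = homogeneous_2_local_relations[OF n \<omega>]
  have M: "M \<in> carrier_mat 2 2" and N: "N \<in> carrier_mat 2 2"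
    using \<omega> by (auto simp: homogeneous_2_local_def GL_carrier_mat)
  have "\<not> (N = 1\<^sub>m 2 \<and> M = antidiag b)" for b
  proof
    assume "N = 1\<^sub>m 2 \<and> M = antidiag b"
    \<comment> \<open>With trivial \<open>\<rho>\<close>, the mixed relation identifies the images of \<open>\<ell>\<^sub>1\<close> and \<open>\<ell>\<^sub>2\<close>.\<close>
    then have "pad_block 3 0 (antidiag b) = pad_block 3 1 (antidiag b)"
      using rels(5) by (simp add: left_mult_one_mat[of _ 3 3] right_mult_one_mat[of _ 3 3])
    then show False using pad_block_antidiag_shift_neq by blast
  qed
  then show thesis
    using involution_braid_cases[OF M rels(1,3)] involution_braid_cases[OF N rels(2,4)] that by metis
qed

section \<open>Factoring through the welded triplet group\<close>

lemma defines_rep_of_WL_iff: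
  assumes \<omega>: "\<omega> \<in> hom (VL n) (GL n)"
  shows "defines_rep_of_WL n \<omega> \<longleftrightarrow> (\<forall>i. 1 \<le> i \<and> i + 1 < n \<longrightarrow>
    \<omega> (rho n i) * (\<omega> (ell n (i + 1)) * \<omega> (ell n i)) = \<omega> (ell n (i + 1)) * (\<omega> (ell n i) * \<omega> (rho n (i + 1))))"
proof -
  interpret group_hom "VL n" "GL n" \<omega>
    using \<omega> by (simp add: group_hom_def group_hom_axioms_def group_VL group_GL)
  have sub: "welded_relators n \<subseteq> carrier (VL n)"
    by (auto simp: welded_relators_def ell_closed rho_closed)
  have rel: "\<omega> (rho n i \<otimes>\<^bsub>VL n\<^esub> ell n (i+1) \<otimes>\<^bsub>VL n\<^esub> ell n i
        \<otimes>\<^bsub>VL n\<^esub> inv\<^bsub>VL n\<^esub> (ell n (i+1) \<otimes>\<^bsub>VL n\<^esub> ell n i \<otimes>\<^bsub>VL n\<^esub> rho n (i+1))) = \<one>\<^bsub>GL n\<^esub>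
    \<longleftrightarrow> \<omega> (rho n i) \<otimes>\<^bsub>GL n\<^esub> (\<omega> (ell n (i + 1)) \<otimes>\<^bsub>GL n\<^esub> \<omega> (ell n i))
      = \<omega> (ell n (i + 1)) \<otimes>\<^bsub>GL n\<^esub> (\<omega> (ell n i) \<otimes>\<^bsub>GL n\<^esub> \<omega> (rho n (i + 1)))"
    if "1 \<le> i" "i + 1 < n" for i
  proof -
    have g: "ell n i \<in> carrier (VL n)" "ell n (i + 1) \<in> carrier (VL n)"
      "rho n i \<in> carrier (VL n)" "rho n (i + 1) \<in> carrier (VL n)"
      using that by (auto intro: ell_closed rho_closed)
    show ?thesis
      using H.inv_solve_right'[of "\<one>\<^bsub>GL n\<^esub>" "\<omega> (rho n i \<otimes>\<^bsub>VL n\<^esub> ell n (i+1) \<otimes>\<^bsub>VL n\<^esub> ell n i)"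
          "\<omega> (ell n (i+1) \<otimes>\<^bsub>VL n\<^esub> ell n i \<otimes>\<^bsub>VL n\<^esub> rho n (i+1))"] g
      by (simp add: H.m_assoc)
  qed
  have "defines_rep_of_WL n \<omega> \<longleftrightarrow> (\<forall>a \<in> welded_relators n. \<omega> a = \<one>\<^bsub>GL n\<^esub>)"
    unfolding defines_rep_of_WL_def WL_def welded_kernel_def
    by (rule factors_through_normal_closure_iff[OF sub])
  also have "\<dots> \<longleftrightarrow> (\<forall>i. 1 \<le> i \<and> i + 1 < n \<longrightarrow>
      \<omega> (rho n i) \<otimes>\<^bsub>GL n\<^esub> (\<omega> (ell n (i + 1)) \<otimes>\<^bsub>GL n\<^esub> \<omega> (ell n i))
      = \<omega> (ell n (i + 1)) \<otimes>\<^bsub>GL n\<^esub> (\<omega> (ell n i) \<otimes>\<^bsub>GL n\<^esub> \<omega> (rho n (i + 1))))"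
    unfolding welded_relators_def using rel by blast
  finally show ?thesis by (simp add: GL_simps)
qed

lemma omega1_exists:
  assumes "b \<noteq> 0" "x \<noteq> 0"
  obtains \<omega> where "is_omega1 n b x \<omega>"
proof (rule VL_local_rep_exists[OF antidiag_carrier antidiag_involution[OF assms(1)]
      antidiag_carrier antidiag_involution[OF assms(2)] antidiag_mixed_braid[OF assms(1,1)]
      antidiag_mixed_braid[OF assms(2,2)] antidiag_mixed_braid[OF assms]])
  fix \<omega>
  assume "\<omega> \<in> hom (VL n) (GL n)"
    "\<And>i. 1 \<le> i \<Longrightarrow> i < n \<Longrightarrow> \<omega> (ell n i) = local_block n i (antidiag b)"
    "\<And>i. 1 \<le> i \<Longrightarrow> i < n \<Longrightarrow> \<omega> (rho n i) = local_block n i (antidiag x)"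
  then have "is_omega1 n b x \<omega>" by (simp add: is_omega1_def)
  then show thesis by (rule that)
qed

lemma omega2_exists:
  assumes "x \<noteq> 0"
  obtains \<omega> where "is_omega2 n x \<omega>"
proof (rule VL_local_rep_exists[of "1\<^sub>m 2" "antidiag x" n])
  show "antidiag x * antidiag x = 1\<^sub>m 2" by (rule antidiag_involution[OF assms])
  show "pad_block 3 0 (antidiag x) * (pad_block 3 1 (antidiag x) * pad_block 3 0 (antidiag x))
    = pad_block 3 1 (antidiag x) * (pad_block 3 0 (antidiag x) * pad_block 3 1 (antidiag x))"
    by (rule antidiag_mixed_braid[OF assms assms])
  show "pad_block 3 0 (antidiag x) * (pad_block 3 1 (antidiag x) * pad_block 3 0 (1\<^sub>m 2))
    = pad_block 3 1 (1\<^sub>m 2) * (pad_block 3 0 (antidiag x) * pad_block 3 1 (antidiag x))"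
    by (simp add: left_mult_one_mat[OF mult_carrier_mat[OF pad_block_carrier pad_block_carrier]]
        right_mult_one_mat[OF pad_block_carrier])
  fix \<omega>
  assume "\<omega> \<in> hom (VL n) (GL n)"
    "\<And>i. 1 \<le> i \<Longrightarrow> i < n \<Longrightarrow> \<omega> (ell n i) = local_block n i (1\<^sub>m 2)"
    "\<And>i. 1 \<le> i \<Longrightarrow> i < n \<Longrightarrow> \<omega> (rho n i) = local_block n i (antidiag x)"
  then have "is_omega2 n x \<omega>" by (simp add: is_omega2_def local_block_one)
  then show thesis by (rule that)
qed simp_all

lemma omega1_welded:
  assumes "b \<noteq> 0" "x \<noteq> 0" and \<omega>: "is_omega1 n b x \<omega>"
  shows "defines_rep_of_WL n \<omega>"
proof -
  have "local_block n i (antidiag x) * (local_block n (i + 1) (antidiag b) * local_block n i (antidiag b))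
    = local_block n (i + 1) (antidiag b) * (local_block n i (antidiag b) * local_block n (i + 1) (antidiag x))"
    if "1 \<le> i" "i + 1 < n" for i
    using local_block_adjacent_relation_iff[OF that antidiag_carrier antidiag_carrier antidiag_carrier
        antidiag_carrier antidiag_carrier antidiag_carrier, of 0 1 0 1 0 1 x b b b b x]
      antidiag_welded[OF assms(1,2)] by simp
  then show ?thesis using \<omega> by (auto simp: is_omega1_def defines_rep_of_WL_iff)
qed

text \<open>With trivial \<open>\<ell>\<close>, the welded relation identifies the images of \<open>\<rho>\<^sub>1\<close> and \<open>\<rho>\<^sub>2\<close>.\<close>

lemma omega2_not_welded:
  assumes n: "n \<ge> 3" and \<omega>: "is_omega2 n x \<omega>"
  shows "\<not> defines_rep_of_WL n \<omega>"
proof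
  assume "defines_rep_of_WL n \<omega>"
  then have "\<omega> (rho n 1) * (\<omega> (ell n 2) * \<omega> (ell n 1)) = \<omega> (ell n 2) * (\<omega> (ell n 1) * \<omega> (rho n 2))"
    using n \<omega> by (auto simp: is_omega2_def defines_rep_of_WL_iff numeral_2_eq_2 dest!: spec[of _ 1])
  moreover have "\<omega> (ell n 1) = 1\<^sub>m n" "\<omega> (ell n 2) = 1\<^sub>m n"
    "\<omega> (rho n 1) = local_block n 1 (antidiag x)" "\<omega> (rho n 2) = local_block n (1 + 1) (antidiag x)"
    using n \<omega> by (auto simp: is_omega2_def numeral_2_eq_2)
  moreover note local_block_adjacent[OF antidiag_carrier[of x], of 1 n]
  ultimately have "pad_block n 0 (pad_block 3 0 (antidiag x)) = pad_block n 0 (pad_block 3 1 (antidiag x))"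
    using n by (simp add: left_mult_one_mat[OF pad_block_carrier] right_mult_one_mat[OF pad_block_carrier])
  then show False
    using n pad_block_antidiag_shift_neq by (simp add: pad_block_inject[of _ 3])
qed

lemma equivalent_reps_refl:
  assumes \<omega>: "\<omega> \<in> hom (VL n) (GL n)"
  shows "equivalent_reps n \<omega> \<omega>"
proof -
  interpret group "GL n" by (rule group_GL)
  have "\<omega> g \<in> carrier (GL n)" if "g \<in> carrier (VL n)" for g
    using \<omega> that by (auto simp: hom_def)
  then show ?thesis
    unfolding equivalent_reps_def by (intro bexI[of _ "\<one>\<^bsub>GL n\<^esub>"]) auto
qed

theorem theorem24:
  fixes n :: nat
  assumes "n \<ge> 3"
  shows
    "(\<forall>\<omega>. nontrivial_homogeneous_2_local n \<omega> \<longrightarrow>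
        (\<exists>\<omega>1 b x. b \<noteq> 0 \<and> x \<noteq> 0 \<and> is_omega1 n b x \<omega>1 \<and> equivalent_reps n \<omega> \<omega>1) \<or>
        (\<exists>\<omega>2 x. x \<noteq> 0 \<and> is_omega2 n x \<omega>2 \<and> equivalent_reps n \<omega> \<omega>2))
   \<and> (\<forall>b x. b \<noteq> 0 \<and> x \<noteq> 0 \<longrightarrow>
        (\<exists>\<omega>1. is_omega1 n b x \<omega>1) \<and>
        (\<forall>\<omega>1. is_omega1 n b x \<omega>1 \<longrightarrow> defines_rep_of_WL n \<omega>1))
   \<and> (\<forall>x. x \<noteq> 0 \<longrightarrow>
        (\<exists>\<omega>2. is_omega2 n x \<omega>2) \<and>
        (\<forall>\<omega>2. is_omega2 n x \<omega>2 \<longrightarrow> \<not> defines_rep_of_WL n \<omega>2))"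
proof (intro conjI allI impI)
  fix \<omega> assume "nontrivial_homogeneous_2_local n \<omega>"
  then obtain M N where loc: "homogeneous_2_local n M N \<omega>" and nontriv: "\<not> (M = 1\<^sub>m 2 \<and> N = 1\<^sub>m 2)"
    by (auto simp: nontrivial_homogeneous_2_local_def)
  have hom: "\<omega> \<in> hom (VL n) (GL n)" using loc by (simp add: homogeneous_2_local_def)
  from homogeneous_2_local_cases[OF assms loc]
  show "(\<exists>\<omega>1 b x. b \<noteq> 0 \<and> x \<noteq> 0 \<and> is_omega1 n b x \<omega>1 \<and> equivalent_reps n \<omega> \<omega>1) \<or>
    (\<exists>\<omega>2 x. x \<noteq> 0 \<and> is_omega2 n x \<omega>2 \<and> equivalent_reps n \<omega> \<omega>2)"
  proof cases
    case 1
    then show ?thesis using nontriv by simp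
  next
    case (2 x)
    then have "is_omega2 n x \<omega>"
      using loc by (simp add: homogeneous_2_local_def is_omega2_def local_block_one)
    then show ?thesis using 2 equivalent_reps_refl[OF hom] by blast
  next
    case (3 b x)
    then have "is_omega1 n b x \<omega>"
      using loc by (simp add: homogeneous_2_local_def is_omega1_def)
    then show ?thesis using 3 equivalent_reps_refl[OF hom] by blast
  qed
next
  fix b x :: complex assume bx: "b \<noteq> 0 \<and> x \<noteq> 0"
  then show "\<exists>\<omega>1. is_omega1 n b x \<omega>1" using omega1_exists[of b x n] by blast
  fix \<omega>1 assume "is_omega1 n b x \<omega>1"
  then show "defines_rep_of_WL n \<omega>1" using bx omega1_welded by blast
next
  fix x :: complex assume "x \<noteq> 0"
  then show "\<exists>\<omega>2. is_omega2 n x \<omega>2" using omega2_exists[of x n] by blast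
next
  fix x \<omega>2 assume "is_omega2 n x \<omega>2"
  then show "\<not> defines_rep_of_WL n \<omega>2" using omega2_not_welded[OF assms] by blast
qed

end
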